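(* Let $(S,\bullet)$ be an adequate partial semigroup. Then $L$ is a minimal closed invariant subset of the PSPDS $(\beta S,\{\lambda_s\}_{s\in S})$ if and only if $L$ is a minimal left ideal of $(\beta S,\bullet)$.
   Context: A partial semigroup is a nonempty set $S$ with a partially defined operation $\bullet$ such that $(x\bullet y)\bullet z=x\bullet(y\bullet z)$ in the sense that if either side is defined so is the other and they are equal. $R(x)=\{s:x\bullet s\text{ defined}\}$, $L(x)=\{s:s\bullet x\text{ defined}\}$; $S$ is adequate if $\bigcap_{s\in H}R(s)\ne\emptyset$ and $\bigcap_{s\in H}L(s)\ne\emptyset$ for all finite nonempty $H\subseteq S$. $\beta S$: ultrafilters on $S$, $\overline{A}=\{p:A\in p\}$; $s^{-1}A=\{t\in R(s):s\bullet t\in A\}$; for $p\in\beta S$, $L(p)=\{s\in S:R(s)\in p\}$; for $p,q$ with $L(q)\in p$, $p\bullet q=\{A:\{s:s^{-1}A\in q\}\in p\}$; $(\beta S,\bullet)$ is a partial semigroup. For $s\in S$, $\lambda_s:\overline{R(s)}\to\beta S$, $\lambda_s(p)=s\bullet p$. A closed invariant subset is a nonempty closed $Y\subseteq\beta S$ with $\lambda_s(p)\in Y$ whenever $p\in Y$ and $\lambda_s(p)$ is defined; it is minimal if it contains no other nonempty closed invariant subset. A left ideal of $\beta S$ is a nonempty $I$ with $y\bullet x\in I$ whenever $x\in I$ and $y\bullet x$ is defined; minimal if it contains no other left ideal. *)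

theory Defs
  imports "HOL-Analysis.Analysis"
begin

text \<open>A partial operation on a carrier \<open>S\<close> is a function into \<open>option\<close>; \<open>None\<close> means undefined.
  Values at arguments outside \<open>S\<close> are irrelevant.\<close>

definition right_dom :: "'a set \<Rightarrow> ('a \<Rightarrow> 'a \<Rightarrow> 'a option) \<Rightarrow> 'a \<Rightarrow> 'a set" where
  "right_dom S f x = {s \<in> S. f x s \<noteq> None}"

definition left_dom :: "'a set \<Rightarrow> ('a \<Rightarrow> 'a \<Rightarrow> 'a option) \<Rightarrow> 'a \<Rightarrow> 'a set" where
  "left_dom S f x = {s \<in> S. f s x \<noteq> None}"

text \<open>In the associativity axiom both sides are elements of \<open>option\<close>, so the equation says that
  either side is defined iff the other is, and that the values then agree.\<close>

locale partial_semigroup =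
  fixes S :: "'a set" and f :: "'a \<Rightarrow> 'a \<Rightarrow> 'a option"
  assumes nonempty: "S \<noteq> {}"
    and closed: "\<And>x y z. \<lbrakk>x \<in> S; y \<in> S; f x y = Some z\<rbrakk> \<Longrightarrow> z \<in> S"
    and assoc: "\<And>x y z. \<lbrakk>x \<in> S; y \<in> S; z \<in> S\<rbrakk> \<Longrightarrow>
      Option.bind (f x y) (\<lambda>u. f u z) = Option.bind (f y z) (\<lambda>v. f x v)"

locale adequate_partial_semigroup = partial_semigroup +
  assumes adequate_right: "\<And>H. \<lbrakk>finite H; H \<noteq> {}; H \<subseteq> S\<rbrakk> \<Longrightarrow> (\<Inter>s\<in>H. right_dom S f s) \<noteq> {}"
    and adequate_left: "\<And>H. \<lbrakk>finite H; H \<noteq> {}; H \<subseteq> S\<rbrakk> \<Longrightarrow> (\<Inter>s\<in>H. left_dom S f s) \<noteq> {}"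

definition left_ideal :: "'a set \<Rightarrow> ('a \<Rightarrow> 'a \<Rightarrow> 'a option) \<Rightarrow> 'a set \<Rightarrow> bool" where
  "left_ideal S f I \<longleftrightarrow> I \<noteq> {} \<and> I \<subseteq> S \<and> (\<forall>x\<in>I. \<forall>y\<in>S. \<forall>z. f y x = Some z \<longrightarrow> z \<in> I)"

definition minimal_left_ideal :: "'a set \<Rightarrow> ('a \<Rightarrow> 'a \<Rightarrow> 'a option) \<Rightarrow> 'a set \<Rightarrow> bool" where
  "minimal_left_ideal S f I \<longleftrightarrow>
     left_ideal S f I \<and> (\<forall>J. left_ideal S f J \<and> J \<subseteq> I \<longrightarrow> J = I)"

definition ultrafilter_on :: "'a set \<Rightarrow> 'a set set \<Rightarrow> bool" where
  "ultrafilter_on S p \<longleftrightarrow>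
     p \<subseteq> Pow S \<and> S \<in> p \<and> {} \<notin> p \<and>
     (\<forall>A\<in>p. \<forall>B\<in>p. A \<inter> B \<in> p) \<and>
     (\<forall>A\<in>p. \<forall>B. A \<subseteq> B \<and> B \<subseteq> S \<longrightarrow> B \<in> p) \<and>
     (\<forall>A. A \<subseteq> S \<longrightarrow> A \<in> p \<or> S - A \<in> p)"

definition beta :: "'a set \<Rightarrow> 'a set set set" where
  "beta S = {p. ultrafilter_on S p}"

definition beta_closure :: "'a set \<Rightarrow> 'a set \<Rightarrow> 'a set set set" where
  "beta_closure S A = {p \<in> beta S. A \<in> p}"

definition beta_topology :: "'a set \<Rightarrow> 'a set set topology" where
  "beta_topology S = topology_generated_by {beta_closure S A |A. A \<subseteq> S}"

definition principal_ultrafilter :: "'a set \<Rightarrow> 'a \<Rightarrow> 'a set set" where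
  "principal_ultrafilter S s = {A. A \<subseteq> S \<and> s \<in> A}"

definition left_quotient :: "'a set \<Rightarrow> ('a \<Rightarrow> 'a \<Rightarrow> 'a option) \<Rightarrow> 'a \<Rightarrow> 'a set \<Rightarrow> 'a set" where
  "left_quotient S f s A = {t \<in> right_dom S f s. the (f s t) \<in> A}"

definition beta_left_dom :: "'a set \<Rightarrow> ('a \<Rightarrow> 'a \<Rightarrow> 'a option) \<Rightarrow> 'a set set \<Rightarrow> 'a set" where
  "beta_left_dom S f p = {s \<in> S. right_dom S f s \<in> p}"

definition beta_mult ::
  "'a set \<Rightarrow> ('a \<Rightarrow> 'a \<Rightarrow> 'a option) \<Rightarrow> 'a set set \<Rightarrow> 'a set set \<Rightarrow> 'a set set option" where
  "beta_mult S f p q =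
     (if beta_left_dom S f q \<in> p
      then Some {A. A \<subseteq> S \<and> {s \<in> S. left_quotient S f s A \<in> q} \<in> p}
      else None)"

text \<open>The translation by \<open>s\<close> multiplies by the principal ultrafilter of \<open>s\<close>, under the usual
  identification of \<open>S\<close> with a subset of \<open>beta S\<close>.\<close>

definition beta_translation ::
  "'a set \<Rightarrow> ('a \<Rightarrow> 'a \<Rightarrow> 'a option) \<Rightarrow> 'a \<Rightarrow> 'a set set \<Rightarrow> 'a set set option" where
  "beta_translation S f s p =
     (if p \<in> beta_closure S (right_dom S f s)
      then beta_mult S f (principal_ultrafilter S s) p
      else None)"

definition closed_invariant ::
  "'x topology \<Rightarrow> 's set \<Rightarrow> ('s \<Rightarrow> 'x \<Rightarrow> 'x option) \<Rightarrow> 'x set \<Rightarrow> bool" where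
  "closed_invariant X S T Y \<longleftrightarrow>
     Y \<noteq> {} \<and> closedin X Y \<and> (\<forall>s\<in>S. \<forall>x\<in>Y. \<forall>y. T s x = Some y \<longrightarrow> y \<in> Y)"

definition minimal_closed_invariant ::
  "'x topology \<Rightarrow> 's set \<Rightarrow> ('s \<Rightarrow> 'x \<Rightarrow> 'x option) \<Rightarrow> 'x set \<Rightarrow> bool" where
  "minimal_closed_invariant X S T Y \<longleftrightarrow>
     closed_invariant X S T Y \<and> (\<forall>Z. closed_invariant X S T Z \<and> Z \<subseteq> Y \<longrightarrow> Z = Y)"

end

theory Submission
  imports Defs
begin

text \<open>
  The operation of \<open>\<beta>S\<close> is continuous in its left argument, so a closed invariant set is a left
  ideal, while every left ideal is trivially invariant. It remains to see that every left ideal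
  contains a closed left ideal. Let \<open>q\<close> be one of its elements. If \<open>L(q)\<close> is empty, then \<open>{q}\<close> is
  such a closed left ideal. Otherwise \<open>\<beta>S \<bullet> q\<close> is a left ideal by associativity, and it is closed
  because it consists of those \<open>r\<close> all of whose members \<open>A\<close> satisfy \<open>s\<inverse>A \<in> q\<close> for some \<open>s\<close>.
\<close>

section \<open>Ultrafilters on a set\<close>

lemma ultrafilter_onD:
  assumes "ultrafilter_on S p"
  shows ultrafilter_on_subset: "A \<in> p \<Longrightarrow> A \<subseteq> S"
    and ultrafilter_on_carrier: "S \<in> p"
    and ultrafilter_on_empty: "{} \<notin> p"
    and ultrafilter_on_Int: "A \<in> p \<Longrightarrow> B \<in> p \<Longrightarrow> A \<inter> B \<in> p"
    and ultrafilter_on_mono: "A \<in> p \<Longrightarrow> A \<subseteq> B \<Longrightarrow> B \<subseteq> S \<Longrightarrow> B \<in> p"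
    and ultrafilter_on_total: "A \<subseteq> S \<Longrightarrow> A \<in> p \<or> S - A \<in> p"
  using assms unfolding ultrafilter_on_def by blast+

lemma ultrafilter_on_Int_iff:
  assumes "ultrafilter_on S p" "A \<subseteq> S" "B \<subseteq> S"
  shows "A \<inter> B \<in> p \<longleftrightarrow> A \<in> p \<and> B \<in> p"
  using ultrafilter_on_Int[OF assms(1)] ultrafilter_on_mono[OF assms(1) _ inf_le1 assms(2)]
    ultrafilter_on_mono[OF assms(1) _ inf_le2 assms(3)] by blast

text \<open>Ultrafilters are maximal: a set in \<open>p\<close> but not in \<open>r\<close> would
  have its complement in \<open>r\<close>, hence in \<open>p\<close> as well. Later, equality of
  ultrafilters is always obtained from one inclusion.\<close>

lemma ultrafilter_on_subset_eq:
  assumes p: "ultrafilter_on S p" and r: "ultrafilter_on S r" and "r \<subseteq> p"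
  shows "p = r"
proof
  show "p \<subseteq> r"
  proof
    fix A assume A: "A \<in> p"
    show "A \<in> r"
    proof (rule ccontr)
      assume "A \<notin> r"
      then have "S - A \<in> p"
        using ultrafilter_on_total[OF r ultrafilter_on_subset[OF p A]] \<open>r \<subseteq> p\<close> by blast
      then have "A \<inter> (S - A) \<in> p" using ultrafilter_on_Int[OF p A] by blast
      then show False using ultrafilter_on_empty[OF p] by (simp add: Int_Diff)
    qed
  qed
qed fact

lemma principal_ultrafilter_in_beta: "s \<in> S \<Longrightarrow> principal_ultrafilter S s \<in> beta S"
  by (auto simp: beta_def ultrafilter_on_def principal_ultrafilter_def)

section \<open>Extension of filter bases to ultrafilters\<close>

text \<open>Upward closure is left out on purpose: the families to be extended later are images of
  ultrafilters under a map that preserves intersections.\<close>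

definition filter_base_on :: "'a set \<Rightarrow> 'a set set \<Rightarrow> bool" where
  "filter_base_on S F \<longleftrightarrow>
     F \<noteq> {} \<and> F \<subseteq> Pow S \<and> {} \<notin> F \<and> (\<forall>A\<in>F. \<forall>B\<in>F. A \<inter> B \<in> F)"

text \<open>The family is the filter on \<open>S\<close> generated by the traces on
  \<open>B\<close>; it is how a set compatible with \<open>F\<close> is adjoined to
  \<open>F\<close>.\<close>

lemma filter_base_on_trace:
  assumes F: "filter_base_on S F" and ne: "\<And>A. A \<in> F \<Longrightarrow> A \<inter> B \<noteq> {}"
  shows "filter_base_on S {C. C \<subseteq> S \<and> (\<exists>A\<in>F. A \<inter> B \<subseteq> C)}" (is "filter_base_on S ?G")
proof -
  obtain A where "A \<in> F" "A \<subseteq> S" using F unfolding filter_base_on_def by auto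
  then have "?G \<noteq> {}" by auto
  moreover have "C \<inter> D \<in> ?G" if C: "C \<in> ?G" and D: "D \<in> ?G" for C D
  proof -
    obtain A A' where "A \<in> F" "A' \<in> F" "A \<inter> B \<subseteq> C" "A' \<inter> B \<subseteq> D" using C D by blast
    moreover from this have "A \<inter> A' \<in> F" using F unfolding filter_base_on_def by blast
    moreover have "(A \<inter> A') \<inter> B \<subseteq> C \<inter> D" using calculation by blast
    ultimately show ?thesis using C D by blast
  qed
  moreover have "{} \<notin> ?G" using ne by auto
  ultimately show ?thesis unfolding filter_base_on_def by auto
qed

text \<open>Maximality absorbs the filter of traces on any \<open>B\<close> that meets all members
  of \<open>M\<close>. If \<open>B\<close> fails to meet some member, that member lies in
  \<open>S - B\<close>.\<close>

lemma filter_base_on_maximal_ultrafilter: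
  assumes M: "filter_base_on S M"
    and max: "\<And>G. filter_base_on S G \<Longrightarrow> M \<subseteq> G \<Longrightarrow> G = M"
  shows "ultrafilter_on S M"
proof -
  have trace: "C \<in> M"
    if "\<And>A. A \<in> M \<Longrightarrow> A \<inter> B \<noteq> {}" "A \<in> M" "A \<inter> B \<subseteq> C" "C \<subseteq> S" for A B C
  proof -
    let ?G = "{C. C \<subseteq> S \<and> (\<exists>A\<in>M. A \<inter> B \<subseteq> C)}"
    have "M \<subseteq> ?G" using M unfolding filter_base_on_def by auto
    then have "?G = M" using max filter_base_on_trace[OF M that(1)] by blast
    then show ?thesis using that by blast
  qed
  obtain A0 where A0: "A0 \<in> M" "A0 \<subseteq> S" using M unfolding filter_base_on_def by auto
  have ne: "A \<noteq> {}" if "A \<in> M" for A using M that unfolding filter_base_on_def by auto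
  \<comment> \<open>With \<open>UNIV\<close> in place of \<open>B\<close> the traces are the members
    of \<open>M\<close> themselves, so absorption becomes upward closure.\<close>
  have mono: "C \<in> M" if "A \<in> M" "A \<subseteq> C" "C \<subseteq> S" for A C
    by (rule trace[of UNIV A C]) (use that ne in auto)
  have "B \<in> M \<or> S - B \<in> M" if B: "B \<subseteq> S" for B
  proof (cases "\<forall>A\<in>M. A \<inter> B \<noteq> {}")
    case True
    then show ?thesis using trace[of B A0 B] A0(1) B by simp
  next
    case False
    then obtain A where "A \<in> M" "A \<inter> B = {}" by blast
    moreover have "A \<subseteq> S - B" using calculation M unfolding filter_base_on_def by blast
    ultimately show ?thesis using mono by blast
  qed
  moreover have "S \<in> M" using mono A0 by blast
  moreover have "M \<subseteq> Pow S" "{} \<notin> M" "\<forall>A\<in>M. \<forall>B\<in>M. A \<inter> B \<in> M"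
    using M unfolding filter_base_on_def by auto
  moreover have "\<forall>A\<in>M. \<forall>B. A \<subseteq> B \<and> B \<subseteq> S \<longrightarrow> B \<in> M" using mono by blast
  ultimately show ?thesis unfolding ultrafilter_on_def by simp
qed

lemma filter_base_on_extends_to_ultrafilter:
  assumes F: "filter_base_on S F"
  obtains p where "ultrafilter_on S p" "F \<subseteq> p"
proof -
  let ?P = "{G. filter_base_on S G \<and> F \<subseteq> G}"
  have "\<exists>M\<in>?P. \<forall>G\<in>?P. M \<subseteq> G \<longrightarrow> G = M"
  proof (rule subset_Zorn_nonempty)
    show "?P \<noteq> {}" using F by blast
  next
    fix C assume ne: "C \<noteq> {}" and ch: "subset.chain ?P C"
    have mem: "filter_base_on S G" "F \<subseteq> G" if "G \<in> C" for G
      using ch that unfolding subset_chain_def by blast+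
    have "A \<inter> B \<in> \<Union>C" if "A \<in> \<Union>C" "B \<in> \<Union>C" for A B
    proof -
      obtain G H where GH: "G \<in> C" "H \<in> C" "A \<in> G" "B \<in> H" using \<open>A \<in> \<Union>C\<close> \<open>B \<in> \<Union>C\<close> by blast
      then have "G \<subseteq> H \<or> H \<subseteq> G" using ch unfolding subset_chain_def by blast
      then obtain K where "K \<in> C" "A \<in> K" "B \<in> K" using GH by blast
      then show ?thesis using mem(1) unfolding filter_base_on_def by blast
    qed
    moreover have "\<Union>C \<subseteq> Pow S" "{} \<notin> \<Union>C"
      using mem(1) unfolding filter_base_on_def by blast+
    moreover have "F \<subseteq> \<Union>C" using ne mem(2) by blast
    moreover have "\<Union>C \<noteq> {}"
      using F \<open>F \<subseteq> \<Union>C\<close> unfolding filter_base_on_def by (metis subset_empty)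
    ultimately show "\<Union>C \<in> ?P" unfolding filter_base_on_def by (intro CollectI conjI ballI)
  qed
  then obtain M where M: "M \<in> ?P" and max: "\<forall>G\<in>?P. M \<subseteq> G \<longrightarrow> G = M" ..
  have "ultrafilter_on S M"
  proof (rule filter_base_on_maximal_ultrafilter)
    \<comment> \<open>A filter base above \<open>M\<close> still contains \<open>F\<close>, so
      maximality in \<open>?P\<close> is maximality among all filter bases.\<close>
    fix G assume G: "filter_base_on S G" "M \<subseteq> G"
    then have "G \<in> ?P" using M by auto
    then show "G = M" using max G(2) by simp
  qed (use M in simp)
  then show thesis using that M by simp
qed

section \<open>The topology of \<open>\<beta>S\<close>\<close>

lemma topspace_beta_topology [simp]: "topspace (beta_topology S) = beta S"
proof -
  have "beta_closure S S = beta S"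
    by (auto simp: beta_closure_def beta_def ultrafilter_on_def)
  then show ?thesis
    unfolding beta_topology_def topology_generated_by_topspace
    by (auto simp: beta_closure_def)
qed

lemma openin_beta_closure: "A \<subseteq> S \<Longrightarrow> openin (beta_topology S) (beta_closure S A)"
  unfolding beta_topology_def by (rule topology_generated_by_Basis) blast

text \<open>The topology is defined by a subbase, but the generating sets form a base: an
  ultrafilter contains \<open>A \<inter> B\<close> exactly when it contains \<open>A\<close> and
  \<open>B\<close>.\<close>

lemma openin_beta_topology_basis:
  assumes "openin (beta_topology S) U" "p \<in> U"
  obtains A where "A \<in> p" "beta_closure S A \<subseteq> U"
proof -
  have "generate_topology_on {beta_closure S A |A. A \<subseteq> S} U"
    using assms(1) by (simp add: beta_topology_def openin_topology_generated_by_iff)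
  \<comment> \<open>The conjunct \<open>p \<in> beta S\<close> is carried through the induction
    because the intersection case needs \<open>p\<close> to be an ultrafilter.\<close>
  then have "p \<in> U \<longrightarrow> p \<in> beta S \<and> (\<exists>A. A \<in> p \<and> beta_closure S A \<subseteq> U)"
  proof induction
    case (Int U V)
    show ?case
    proof
      assume "p \<in> U \<inter> V"
      then obtain A B where p: "p \<in> beta S" and AB: "A \<in> p" "B \<in> p"
        "beta_closure S A \<subseteq> U" "beta_closure S B \<subseteq> V" using Int.IH by blast
      then have "A \<inter> B \<in> p" "A \<subseteq> S" "B \<subseteq> S"
        using ultrafilter_on_Int ultrafilter_on_subset unfolding beta_def by blast+
      moreover have "beta_closure S (A \<inter> B) \<subseteq> U \<inter> V"
        using AB \<open>A \<subseteq> S\<close> \<open>B \<subseteq> S\<close>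
        by (auto simp: beta_closure_def beta_def ultrafilter_on_Int_iff)
      ultimately show "p \<in> beta S \<and> (\<exists>A. A \<in> p \<and> beta_closure S A \<subseteq> U \<inter> V)" using p by blast
    qed
  next
    case (UN K)
    then show ?case by (meson Union_iff Union_upper order_trans)
  qed (auto simp: beta_closure_def)
  then show thesis using that assms(2) by blast
qed

lemma closedin_beta_topologyI:
  assumes "Y \<subseteq> beta S"
    and "\<And>r. r \<in> beta S \<Longrightarrow> r \<notin> Y \<Longrightarrow> \<exists>A\<in>r. beta_closure S A \<inter> Y = {}"
  shows "closedin (beta_topology S) Y"
  unfolding closedin_def topspace_beta_topology
proof
  show "openin (beta_topology S) (beta S - Y)"
  proof (subst openin_subopen, intro ballI)
    fix r assume r: "r \<in> beta S - Y"
    then obtain A where A: "A \<in> r" "beta_closure S A \<inter> Y = {}" using assms(2) by blast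
    then have "A \<subseteq> S" using r ultrafilter_on_subset unfolding beta_def by blast
    moreover have "r \<in> beta_closure S A" using r A by (simp add: beta_closure_def)
    moreover have "beta_closure S A \<subseteq> beta S - Y" using A by (auto simp: beta_closure_def)
    ultimately show "\<exists>T. openin (beta_topology S) T \<and> r \<in> T \<and> T \<subseteq> beta S - Y"
      using openin_beta_closure by blast
  qed
qed fact

text \<open>An ultrafilter other than \<open>q\<close> is not included in \<open>q\<close>, and any
  of its members outside \<open>q\<close> gives a neighbourhood that misses
  \<open>q\<close>.\<close>

lemma closedin_beta_singleton:
  assumes "q \<in> beta S"
  shows "closedin (beta_topology S) {q}"
proof (rule closedin_beta_topologyI)
  fix r assume r: "r \<in> beta S" "r \<notin> {q}"
  then have "\<not> r \<subseteq> q" using ultrafilter_on_subset_eq assms unfolding beta_def by blast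
  then show "\<exists>A\<in>r. beta_closure S A \<inter> {q} = {}" by (auto simp: beta_closure_def)
qed (use assms in blast)

section \<open>Multiplication of ultrafilters\<close>

context partial_semigroup
begin

text \<open>The inner set in the definition of the product. For \<open>q \<in> beta S\<close> the
  map \<open>return_set q\<close> is a Boolean homomorphism from the subsets of \<open>S\<close> to
  those of \<open>beta_left_dom S f q\<close>, as the next lemmas show.\<close>

definition return_set :: "'a set set \<Rightarrow> 'a set \<Rightarrow> 'a set" where
  "return_set q A = {s \<in> S. left_quotient S f s A \<in> q}"

lemma left_quotient_subset: "left_quotient S f s A \<subseteq> S"
  by (auto simp: left_quotient_def right_dom_def)

lemma left_quotient_Int: "left_quotient S f s (A \<inter> B) = left_quotient S f s A \<inter> left_quotient S f s B"
  by (auto simp: left_quotient_def)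

lemma left_quotient_carrier: "s \<in> S \<Longrightarrow> left_quotient S f s S = right_dom S f s"
  using closed[of s] by (fastforce simp: left_quotient_def right_dom_def)

lemma return_set_subset: "return_set q A \<subseteq> S"
  by (auto simp: return_set_def)

lemma return_set_carrier: "return_set q S = beta_left_dom S f q"
  by (auto simp: return_set_def beta_left_dom_def left_quotient_carrier)

lemma return_set_Int:
  assumes "q \<in> beta S"
  shows "return_set q (A \<inter> B) = return_set q A \<inter> return_set q B"
proof -
  have "left_quotient S f s (A \<inter> B) \<in> q \<longleftrightarrow>
      left_quotient S f s A \<in> q \<and> left_quotient S f s B \<in> q" for s
    using assms ultrafilter_on_Int_iff[OF _ left_quotient_subset left_quotient_subset, of q]
    by (simp add: beta_def left_quotient_Int)
  then show ?thesis unfolding return_set_def by blast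
qed

lemma return_set_empty: "q \<in> beta S \<Longrightarrow> return_set q {} = {}"
  using ultrafilter_on_empty[of S q] by (auto simp: return_set_def beta_def left_quotient_def)

lemma return_set_mono:
  assumes "q \<in> beta S" "A \<subseteq> B"
  shows "return_set q A \<subseteq> return_set q B"
proof -
  have "A \<inter> B = A" using assms(2) by blast
  then show ?thesis using return_set_Int[OF assms(1), of A B] by auto
qed

text \<open>For \<open>s\<close> in \<open>beta_left_dom S f q\<close>, the set
  \<open>right_dom S f s\<close> belongs to \<open>q\<close> and is split by the quotients of
  \<open>A\<close> and \<open>S - A\<close>, so \<open>q\<close> contains exactly one of them. For
  other \<open>s\<close> it contains neither.\<close>

lemma return_set_Compl:
  assumes q: "q \<in> beta S" and A: "A \<subseteq> S"
  shows "return_set q (S - A) = beta_left_dom S f q - return_set q A"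
proof -
  have "beta_left_dom S f q \<subseteq> return_set q A \<union> return_set q (S - A)"
  proof
    fix s assume s: "s \<in> beta_left_dom S f q"
    have "left_quotient S f s (S - A) \<in> q" if "left_quotient S f s A \<notin> q"
    proof -
      have "S - left_quotient S f s A \<in> q"
        using that q ultrafilter_on_total left_quotient_subset unfolding beta_def by blast
      then have "right_dom S f s \<inter> (S - left_quotient S f s A) \<in> q"
        using s q ultrafilter_on_Int unfolding beta_def beta_left_dom_def by blast
      \<comment> \<open>Here \<open>closed\<close> enters: a defined product that misses
        \<open>A\<close> must lie in \<open>S - A\<close>.\<close>
      moreover have "right_dom S f s \<inter> (S - left_quotient S f s A) = left_quotient S f s (S - A)"
        using s closed[of s] by (fastforce simp: left_quotient_def right_dom_def beta_left_dom_def)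
      ultimately show ?thesis by simp
    qed
    then show "s \<in> return_set q A \<union> return_set q (S - A)"
      using s by (auto simp: return_set_def beta_left_dom_def)
  qed
  moreover have "return_set q A \<inter> return_set q (S - A) = {}"
    using return_set_Int[OF q, of A "S - A"] return_set_empty[OF q] by simp
  moreover have "return_set q (S - A) \<subseteq> beta_left_dom S f q"
    using return_set_mono[OF q, of "S - A" S] return_set_carrier by auto
  ultimately show ?thesis by blast
qed

lemma beta_mult_eq:
  "beta_mult S f p q = Some r \<longleftrightarrow>
     beta_left_dom S f q \<in> p \<and> r = {A. A \<subseteq> S \<and> return_set q A \<in> p}"
  by (auto simp: beta_mult_def return_set_def)

text \<open>The product is the preimage of \<open>p\<close> under the Boolean homomorphism
  \<open>return_set q\<close>, and definedness says that the top element of the target lies in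
  \<open>p\<close>.\<close>

lemma beta_mult_in_beta:
  assumes p: "p \<in> beta S" and q: "q \<in> beta S" and r: "beta_mult S f p q = Some r"
  shows "r \<in> beta S"
proof -
  have p': "ultrafilter_on S p" using p by (simp add: beta_def)
  have dom: "beta_left_dom S f q \<in> p" and r_eq: "r = {A. A \<subseteq> S \<and> return_set q A \<in> p}"
    using r by (auto simp: beta_mult_eq)
  have "S - A \<in> r" if A: "A \<subseteq> S" "A \<notin> r" for A
  proof -
    have "S - return_set q A \<in> p"
      using A ultrafilter_on_total[OF p' return_set_subset] by (auto simp: r_eq)
    then have "beta_left_dom S f q \<inter> (S - return_set q A) \<in> p"
      using ultrafilter_on_Int[OF p' dom] by blast
    moreover have "beta_left_dom S f q \<inter> (S - return_set q A) = return_set q (S - A)"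
      using ultrafilter_on_subset[OF p' dom] return_set_Compl[OF q A(1)] by blast
    ultimately show ?thesis by (simp add: r_eq)
  qed
  moreover have "S \<in> r" using dom by (simp add: r_eq return_set_carrier)
  moreover have "{} \<notin> r"
    using ultrafilter_on_empty[OF p'] by (simp add: r_eq return_set_empty[OF q])
  moreover have "A \<inter> B \<in> r" if "A \<in> r" "B \<in> r" for A B
    using that ultrafilter_on_Int[OF p'] by (auto simp: r_eq return_set_Int[OF q])
  moreover have "B \<in> r" if "A \<in> r" "A \<subseteq> B" "B \<subseteq> S" for A B
    using that ultrafilter_on_mono[OF p' _ return_set_mono[OF q] return_set_subset]
    by (auto simp: r_eq)
  moreover have "r \<subseteq> Pow S" by (auto simp: r_eq)
  ultimately show ?thesis unfolding beta_def ultrafilter_on_def by blast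
qed

section \<open>Associativity of the product\<close>

lemma left_quotient_left_quotient:
  assumes "s \<in> S" "t \<in> S" "f s t = Some u"
  shows "left_quotient S f t (left_quotient S f s A) = left_quotient S f u A"
proof -
  have "x \<in> left_quotient S f t (left_quotient S f s A) \<longleftrightarrow> x \<in> left_quotient S f u A"
    if x: "x \<in> S" for x
    using assoc[OF assms(1,2) x] assms closed[OF assms(2) x] x
    by (cases "f t x") (auto simp: left_quotient_def right_dom_def)
  then show ?thesis using left_quotient_subset by blast
qed

text \<open>By \<open>assoc\<close>, a product of \<open>s\<close> with a defined product of
  \<open>t\<close> and \<open>x\<close> cannot exist when \<open>f s t\<close> does not.\<close>

lemma left_quotient_left_quotient_undefined:
  assumes "s \<in> S" "t \<in> S" "f s t = None"
  shows "left_quotient S f t (left_quotient S f s A) = {}"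
proof -
  have "x \<notin> left_quotient S f t (left_quotient S f s A)" if x: "x \<in> S" for x
    using assoc[OF assms(1,2) x] assms
    by (cases "f t x") (auto simp: left_quotient_def right_dom_def)
  then show ?thesis using left_quotient_subset by blast
qed

text \<open>Where \<open>f s t = Some u\<close>, membership of \<open>t\<close> on either side
  amounts to \<open>u \<in> return_set q A\<close>. Where it is undefined, both sides exclude
  \<open>t\<close>, the left one because \<open>{} \<notin> q\<close>. This commutation carries
  associativity from \<open>S\<close> to \<open>beta S\<close>.\<close>

lemma return_set_left_quotient:
  assumes q: "q \<in> beta S" and s: "s \<in> S"
  shows "return_set q (left_quotient S f s A) = left_quotient S f s (return_set q A)"
proof -
  have "t \<in> return_set q (left_quotient S f s A) \<longleftrightarrow> t \<in> left_quotient S f s (return_set q A)"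
    if t: "t \<in> S" for t
  proof (cases "f s t")
    case None
    then have "t \<notin> left_quotient S f s (return_set q A)"
      by (simp add: left_quotient_def right_dom_def)
    moreover have "t \<notin> return_set q (left_quotient S f s A)"
      using q ultrafilter_on_empty
      by (auto simp: return_set_def beta_def left_quotient_left_quotient_undefined[OF s t None])
    ultimately show ?thesis by blast
  next
    case (Some u)
    then have "t \<in> left_quotient S f s (return_set q A) \<longleftrightarrow> u \<in> return_set q A"
      using t by (simp add: left_quotient_def right_dom_def)
    moreover have "t \<in> return_set q (left_quotient S f s A) \<longleftrightarrow> u \<in> return_set q A"
      using t closed[OF s t Some]
      by (simp add: return_set_def left_quotient_left_quotient[OF s t Some])
    ultimately show ?thesis by blast
  qed
  then show ?thesis using left_quotient_subset return_set_subset by blast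
qed

text \<open>The return set map of a product is the composition of those of its factors, so both
  groupings pull \<open>r\<close> back along the same map.\<close>

lemma beta_mult_assoc:
  assumes p: "p \<in> beta S" and q: "q \<in> beta S" and r: "r \<in> beta S"
    and pq: "beta_mult S f p q = Some u" and ru: "beta_mult S f r u = Some v"
  obtains w where "beta_mult S f r p = Some w" "beta_mult S f w q = Some v"
proof -
  have p': "ultrafilter_on S p" and r': "ultrafilter_on S r" using p r by (auto simp: beta_def)
  have u: "u = {A. A \<subseteq> S \<and> return_set q A \<in> p}" using pq by (simp add: beta_mult_eq)
  have v: "return_set u S \<in> r" "v = {A. A \<subseteq> S \<and> return_set u A \<in> r}"
    using ru by (auto simp: beta_mult_eq return_set_carrier)
  have comp: "return_set u A = return_set p (return_set q A)" for A
  proof -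
    have "left_quotient S f s A \<in> u \<longleftrightarrow> left_quotient S f s (return_set q A) \<in> p" if "s \<in> S" for s
      using return_set_left_quotient[OF q that, of A] left_quotient_subset by (simp add: u)
    then show ?thesis unfolding return_set_def[of u] return_set_def[of p] by blast
  qed
  \<comment> \<open>Definedness of the inner product: since
    \<open>return_set q S \<subseteq> S\<close>, monotonicity puts \<open>return_set u S\<close>
    inside \<open>return_set p S\<close>.\<close>
  have "return_set p S \<in> r"
    using ultrafilter_on_mono[OF r' v(1)] return_set_mono[OF p return_set_subset]
      return_set_subset comp by metis
  then have "beta_mult S f r p = Some {A. A \<subseteq> S \<and> return_set p A \<in> r}" (is "_ = Some ?w")
    by (simp add: beta_mult_eq return_set_carrier)
  moreover have "beta_mult S f ?w q = Some v"
    using v return_set_subset by (simp add: beta_mult_eq comp flip: return_set_carrier)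
  ultimately show thesis by (rule that)
qed

text \<open>Both guards say that \<open>right_dom S f s \<in> q\<close>.\<close>

lemma beta_translation_eq:
  assumes "s \<in> S" "q \<in> beta S"
  shows "beta_translation S f s q = beta_mult S f (principal_ultrafilter S s) q"
  using assms
  by (auto simp: beta_translation_def beta_closure_def beta_mult_def beta_left_dom_def
      principal_ultrafilter_def)

section \<open>Closed invariant sets and left ideals\<close>

lemma closed_invariant_iff_left_ideal:
  assumes cl: "closedin (beta_topology S) Y"
  shows "closed_invariant (beta_topology S) S (beta_translation S f) Y \<longleftrightarrow>
         left_ideal (beta S) (beta_mult S f) Y"
proof
  have sub: "Y \<subseteq> beta S" using closedin_subset[OF cl] by simp
  {
    assume "left_ideal (beta S) (beta_mult S f) Y"
    then have ne: "Y \<noteq> {}"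
      and mult: "\<And>p q r. q \<in> Y \<Longrightarrow> p \<in> beta S \<Longrightarrow> beta_mult S f p q = Some r \<Longrightarrow> r \<in> Y"
      unfolding left_ideal_def by blast+
    have "r \<in> Y" if "s \<in> S" "q \<in> Y" "beta_translation S f s q = Some r" for s q r
      using that mult[OF that(2) principal_ultrafilter_in_beta[OF that(1)]] sub
      by (simp add: beta_translation_eq subset_iff)
    then show "closed_invariant (beta_topology S) S (beta_translation S f) Y"
      using cl ne unfolding closed_invariant_def by blast
  next
    assume inv: "closed_invariant (beta_topology S) S (beta_translation S f) Y"
    have "r \<in> Y" if q: "q \<in> Y" and p: "p \<in> beta S" and pq: "beta_mult S f p q = Some r" for p q r
    proof (rule ccontr)
      assume "r \<notin> Y"
      have qb: "q \<in> beta S" using q sub by blast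
      have "r \<in> beta S - Y" using \<open>r \<notin> Y\<close> beta_mult_in_beta[OF p qb pq] by blast
      moreover have "openin (beta_topology S) (beta S - Y)"
        using cl by (simp add: closedin_def)
      ultimately obtain A where A: "A \<in> r" "beta_closure S A \<subseteq> beta S - Y"
        using openin_beta_topology_basis by metis
      then have AS: "A \<subseteq> S" and ret: "return_set q A \<in> p" using pq by (auto simp: beta_mult_eq)
      moreover have "{} \<notin> p" using p ultrafilter_on_empty unfolding beta_def by blast
      \<comment> \<open>Continuity in the left argument: \<open>p\<close> is replaced by a point
        \<open>s\<close> of \<open>return_set q A\<close>. Then the translate of \<open>q\<close> by
        \<open>s\<close> is defined and contains \<open>A\<close>, so it lies in a neighbourhood of
        \<open>r\<close> that misses \<open>Y\<close>, against invariance.\<close>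
      ultimately obtain s where s: "s \<in> return_set q A" by (metis equals0I)
      then have sS: "s \<in> S" using return_set_subset by blast
      have "s \<in> beta_left_dom S f q"
        using s return_set_mono[OF qb AS] return_set_carrier by blast
      then obtain t where t: "beta_mult S f (principal_ultrafilter S s) q = Some t"
        by (auto simp: beta_mult_def principal_ultrafilter_def beta_left_dom_def)
      then have "t \<in> Y"
        using inv q sS beta_translation_eq[OF sS qb] unfolding closed_invariant_def by metis
      moreover have "A \<in> t"
        using t s AS return_set_subset by (auto simp: beta_mult_eq principal_ultrafilter_def)
      ultimately show False using A(2) sub by (auto simp: beta_closure_def)
    qed
    then show "left_ideal (beta S) (beta_mult S f) Y"
      using inv sub unfolding left_ideal_def closed_invariant_def by blast
  }
qed

section \<open>Closed left ideals inside left ideals\<close>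

text \<open>The only obstruction to being a multiple of \<open>q\<close> is a member with empty
  return set, and such a member separates \<open>r\<close> from all multiples. Without one, the
  return sets of members of \<open>r\<close> form a filter base, and for an ultrafilter
  \<open>p\<close> above it the product of \<open>p\<close> and \<open>q\<close> includes
  \<open>r\<close>, hence equals it.\<close>

lemma closedin_beta_mult_image:
  assumes q: "q \<in> beta S"
  shows "closedin (beta_topology S) {r. \<exists>p\<in>beta S. beta_mult S f p q = Some r}"
    (is "closedin _ ?Y")
proof (rule closedin_beta_topologyI)
  show "?Y \<subseteq> beta S" using beta_mult_in_beta q by blast
  fix r assume r: "r \<in> beta S" "r \<notin> ?Y"
  then have r': "ultrafilter_on S r" by (simp add: beta_def)
  have "\<exists>A\<in>r. return_set q A = {}"
  proof (rule ccontr)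
    assume ne: "\<not> ?thesis"
    have "filter_base_on S (return_set q ` r)"
      unfolding filter_base_on_def
      using ne return_set_subset ultrafilter_on_carrier[OF r'] ultrafilter_on_Int[OF r']
      by (auto simp flip: return_set_Int[OF q])
    then obtain p where p: "ultrafilter_on S p" "return_set q ` r \<subseteq> p"
      by (rule filter_base_on_extends_to_ultrafilter)
    then have pb: "p \<in> beta S" by (simp add: beta_def)
    \<comment> \<open>From \<open>S \<in> r\<close>, since the return set of \<open>S\<close> is the
      domain of right multiplication by \<open>q\<close>.\<close>
    have "beta_left_dom S f q \<in> p"
      using p(2) ultrafilter_on_carrier[OF r'] by (auto simp flip: return_set_carrier)
    then have pq: "beta_mult S f p q = Some {A. A \<subseteq> S \<and> return_set q A \<in> p}" (is "_ = Some ?u")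
      by (simp add: beta_mult_eq)
    have "r \<subseteq> ?u" using p(2) ultrafilter_on_subset[OF r'] by blast
    then have "?u = r"
      using ultrafilter_on_subset_eq[OF _ r'] beta_mult_in_beta[OF pb q pq]
      unfolding beta_def by blast
    then show False using r pb pq by auto
  qed
  then obtain A where A: "A \<in> r" "return_set q A = {}" by blast
  then have "A \<notin> u" if "u \<in> ?Y" for u
    using that ultrafilter_on_empty[of S] by (auto simp: beta_mult_eq beta_def)
  then show "\<exists>A\<in>r. beta_closure S A \<inter> ?Y = {}" using A(1) unfolding beta_closure_def by blast
qed

lemma left_ideal_contains_closed_left_ideal:
  assumes J: "left_ideal (beta S) (beta_mult S f) J"
  obtains Y where "Y \<subseteq> J" "closedin (beta_topology S) Y" "left_ideal (beta S) (beta_mult S f) Y"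
proof -
  obtain q where q: "q \<in> J" "q \<in> beta S" using J unfolding left_ideal_def by blast
  let ?Y = "{r. \<exists>p\<in>beta S. beta_mult S f p q = Some r}"
  show thesis
  proof (cases "?Y = {}")
    case True
    \<comment> \<open>No product with right factor \<open>q\<close> is defined, so the ideal
      condition for \<open>{q}\<close> is vacuous.\<close>
    then have "left_ideal (beta S) (beta_mult S f) {q}" using q by (auto simp: left_ideal_def)
    then show thesis using that[of "{q}"] closedin_beta_singleton q by blast
  next
    case False
    have "z \<in> ?Y" if u: "u \<in> ?Y" and r: "r \<in> beta S" and z: "beta_mult S f r u = Some z" for u r z
    proof -
      obtain p where p: "p \<in> beta S" "beta_mult S f p q = Some u" using u by blast
      \<comment> \<open>Regrouping exhibits \<open>z\<close> as a multiple of \<open>q\<close>, now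
        with left factor \<open>w\<close>.\<close>
      obtain w where "beta_mult S f r p = Some w" "beta_mult S f w q = Some z"
        by (rule beta_mult_assoc[OF p(1) q(2) r p(2) z])
      then show ?thesis using beta_mult_in_beta[OF r p(1)] by blast
    qed
    moreover have "?Y \<subseteq> beta S" using beta_mult_in_beta q(2) by blast
    ultimately have "left_ideal (beta S) (beta_mult S f) ?Y"
      using False unfolding left_ideal_def by blast
    moreover have "?Y \<subseteq> J" using J q(1) unfolding left_ideal_def by blast
    ultimately show thesis using that closedin_beta_mult_image[OF q(2)] by blast
  qed
qed

end

theorem theorem3p13:
  fixes S :: "'a set" and f :: "'a \<Rightarrow> 'a \<Rightarrow> 'a option" and L :: "'a set set set"
  assumes "adequate_partial_semigroup S f"
  shows "minimal_closed_invariant (beta_topology S) S (beta_translation S f) L \<longleftrightarrow>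
         minimal_left_ideal (beta S) (beta_mult S f) L"
proof -
  interpret adequate_partial_semigroup S f by (rule assms)
  let ?inv = "closed_invariant (beta_topology S) S (beta_translation S f)"
  let ?ideal = "left_ideal (beta S) (beta_mult S f)"
  have inv_iff: "?inv Y \<longleftrightarrow> closedin (beta_topology S) Y \<and> ?ideal Y" for Y
    using closed_invariant_iff_left_ideal[of Y] by (auto simp: closed_invariant_def)
  have contains: "\<exists>Y\<subseteq>J. ?inv Y" if "?ideal J" for J
    using left_ideal_contains_closed_left_ideal[OF that] inv_iff by metis
  show ?thesis
  proof
    assume "minimal_closed_invariant (beta_topology S) S (beta_translation S f) L"
    then have L: "?inv L" and min: "\<And>Z. ?inv Z \<Longrightarrow> Z \<subseteq> L \<Longrightarrow> Z = L"
      unfolding minimal_closed_invariant_def by blast+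
    \<comment> \<open>A closed invariant set inside \<open>J\<close> must be all of
      \<open>L\<close>, which forces \<open>J\<close> up to \<open>L\<close>.\<close>
    have "J = L" if "?ideal J" "J \<subseteq> L" for J
      using contains[OF that(1)] min that(2) by blast
    then show "minimal_left_ideal (beta S) (beta_mult S f) L"
      using L inv_iff unfolding minimal_left_ideal_def by blast
  next
    assume "minimal_left_ideal (beta S) (beta_mult S f) L"
    then have L: "?ideal L" and min: "\<And>J. ?ideal J \<Longrightarrow> J \<subseteq> L \<Longrightarrow> J = L"
      unfolding minimal_left_ideal_def by blast+
    obtain Y where "Y \<subseteq> L" "?inv Y" using contains[OF L] by blast
    \<comment> \<open>This is where \<open>L\<close> turns out to be closed: \<open>Y\<close> is
      itself a left ideal, so minimality gives \<open>Y = L\<close>.\<close>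
    then have "?inv L" using min inv_iff by metis
    then show "minimal_closed_invariant (beta_topology S) S (beta_translation S f) L"
      using min inv_iff unfolding minimal_closed_invariant_def by blast
  qed
qed

end
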